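(* $\mathsf{add}(\mathsf{S}_1(\mathcal{B}_\mathrm{T},\mathcal{B}_\Gamma))=\mathfrak{t}$.
   Context: All spaces $X$ are infinite sets of reals; all covers considered are assumed not to contain $X$ as a member. A cover is a $\gamma$-cover of $X$ if it is infinite and each point lies in all but finitely many members; large if each point lies in infinitely many members. A large cover $\mathcal{U}$ is a $\tau$-cover if for all $x,y\in X$, either ($x\in U\Rightarrow y\in U$) for all but finitely many $U\in\mathcal{U}$, or ($y\in U\Rightarrow x\in U$) for all but finitely many $U\in\mathcal{U}$. $\mathcal{B}_\Gamma,\mathcal{B}_\mathrm{T}$ are the collections of countable Borel $\gamma$-, $\tau$-covers. $X$ satisfies $\mathsf{S}_1(\mathcal{B}_\mathrm{T},\mathcal{B}_\Gamma)$ if for every sequence $(\mathcal{U}_n)$ of members of $\mathcal{B}_\mathrm{T}$ there are $U_n\in\mathcal{U}_n$ with $\{U_n:n\in\mathbb{N}\}\in\mathcal{B}_\Gamma$. For a class $\mathcal{J}$ of sets of reals, $\mathsf{add}(\mathcal{J})$ is the minimal cardinality of a collection $\mathcal{F}\subseteq\mathcal{J}$ with $\bigcup\mathcal{F}\notin\mathcal{J}$. $\mathfrak{t}$ is the minimal size of a tower: a family of infinite subsets of $\mathbb{N}$ linearly quasiordered by $\subseteq^*$ ($a\subseteq^*b$ iff $a\setminus b$ finite) with no infinite $a\subseteq\mathbb{N}$ such that $a\subseteq^*b$ for all its members $b$. *)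

theory Defs
  imports "HOL-Analysis.Analysis"
begin

unbundle cardinal_syntax

section \<open>Covers\<close>

definition cover :: "'a set \<Rightarrow> 'a set set \<Rightarrow> bool" where
  "cover X \<U> \<longleftrightarrow> \<U> \<subseteq> Pow X \<and> \<Union>\<U> = X \<and> X \<notin> \<U>"

definition gamma_cover :: "'a set \<Rightarrow> 'a set set \<Rightarrow> bool" where
  "gamma_cover X \<U> \<longleftrightarrow> cover X \<U> \<and> infinite \<U> \<and> (\<forall>x\<in>X. finite {U \<in> \<U>. x \<notin> U})"

definition large_cover :: "'a set \<Rightarrow> 'a set set \<Rightarrow> bool" where
  "large_cover X \<U> \<longleftrightarrow> cover X \<U> \<and> (\<forall>x\<in>X. infinite {U \<in> \<U>. x \<in> U})"

definition tau_cover :: "'a set \<Rightarrow> 'a set set \<Rightarrow> bool" where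
  "tau_cover X \<U> \<longleftrightarrow> large_cover X \<U> \<and>
     (\<forall>x\<in>X. \<forall>y\<in>X. finite {U \<in> \<U>. \<not> (x \<in> U \<longrightarrow> y \<in> U)} \<or>
                   finite {U \<in> \<U>. \<not> (y \<in> U \<longrightarrow> x \<in> U)})"

text \<open>Members of a Borel cover of \<open>X\<close> are Borel subsets of the subspace \<open>X\<close>, i.e. traces on
  \<open>X\<close> of Borel sets of reals; \<open>X\<close> itself need not be Borel.\<close>

definition countable_borel :: "real set \<Rightarrow> real set set \<Rightarrow> bool" where
  "countable_borel X \<U> \<longleftrightarrow> countable \<U> \<and> \<U> \<subseteq> sets (restrict_space borel X)"

definition B_Gamma :: "real set \<Rightarrow> real set set set" where
  "B_Gamma X = {\<U>. countable_borel X \<U> \<and> gamma_cover X \<U>}"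

definition B_Tau :: "real set \<Rightarrow> real set set set" where
  "B_Tau X = {\<U>. countable_borel X \<U> \<and> tau_cover X \<U>}"


section \<open>The selection principle\<close>

definition selects1 :: "'a set set set \<Rightarrow> 'a set set set \<Rightarrow> bool" where
  "selects1 \<AA> \<BB> \<longleftrightarrow>
     (\<forall>\<U> :: nat \<Rightarrow> 'a set set. (\<forall>n. \<U> n \<in> \<AA>) \<longrightarrow>
        (\<exists>U :: nat \<Rightarrow> 'a set. (\<forall>n. U n \<in> \<U> n) \<and> range U \<in> \<BB>))"

text \<open>The class of spaces (infinite sets of reals) satisfying the selection principle, for
  covers of the space taken from the collections \<open>\<AA> X\<close> and \<open>\<BB> X\<close>.\<close>

definition S1 ::
  "(real set \<Rightarrow> real set set set) \<Rightarrow> (real set \<Rightarrow> real set set set) \<Rightarrow> real set set" where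
  "S1 \<AA> \<BB> = {X. infinite X \<and> selects1 (\<AA> X) (\<BB> X)}"


section \<open>Minimal cardinalities\<close>

text \<open>The least cardinality of a set satisfying \<open>P\<close>; unspecified if no set satisfies \<open>P\<close>.\<close>

definition min_card :: "('a set \<Rightarrow> bool) \<Rightarrow> 'a rel" where
  "min_card P = |SOME A. P A \<and> (\<forall>B. P B \<longrightarrow> |A| \<le>o |B| )|"

lemma min_card_witness:
  fixes P :: "'a set \<Rightarrow> bool"
  assumes "P A0"
  shows "\<exists>A. P A \<and> (\<forall>B. P B \<longrightarrow> |A| \<le>o |B| )"
proof -
  define R :: "'a rel set" where "R = card_of ` Collect P"
  have "R \<noteq> {}" "\<forall>r\<in>R. Card_order r"
    using assms card_of_Card_order unfolding R_def by blast+
  then obtain r where r: "r \<in> R" "\<forall>r'\<in>R. r \<le>o r'"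
    using exists_minim_Card_order[of R] by blast
  then obtain A where "P A" "r = |A|"
    unfolding R_def by blast
  with r(2) show ?thesis
    unfolding R_def by blast
qed

lemma min_card_attained_least:
  assumes "P A0"
  shows "\<exists>A. P A \<and> min_card P = |A| \<and> (\<forall>B. P B \<longrightarrow> min_card P \<le>o |B| )"
proof -
  define M where "M = (SOME A. P A \<and> (\<forall>B. P B \<longrightarrow> |A| \<le>o |B| ))"
  have "P M \<and> (\<forall>B. P B \<longrightarrow> |M| \<le>o |B| )"
    unfolding M_def by (rule someI_ex) (rule min_card_witness[where P = P, OF assms])
  moreover have "min_card P = |M|"
    unfolding min_card_def M_def ..
  ultimately show ?thesis by metis
qed

text \<open>The class \<open>\<J>\<close> consists of infinite sets, so \<open>\<Union>{} \<notin> \<J>\<close>; the condition \<open>\<F> \<noteq> {}\<close> is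
  equivalent to requiring that \<open>\<Union>\<F>\<close> be an infinite set of reals, and prevents the minimum
  from degenerating to 0.\<close>

definition add :: "real set set \<Rightarrow> real set rel" where
  "add \<J> = min_card (\<lambda>\<F>. \<F> \<noteq> {} \<and> \<F> \<subseteq> \<J> \<and> \<Union>\<F> \<notin> \<J>)"


section \<open>The tower number\<close>

definition almost_subset :: "nat set \<Rightarrow> nat set \<Rightarrow> bool" (infix "\<subseteq>*" 50) where
  "a \<subseteq>* b \<longleftrightarrow> finite (a - b)"

definition tower :: "nat set set \<Rightarrow> bool" where
  "tower T \<longleftrightarrow> (\<forall>a\<in>T. infinite a) \<and> (\<forall>a\<in>T. \<forall>b\<in>T. a \<subseteq>* b \<or> b \<subseteq>* a) \<and>
     \<not> (\<exists>a. infinite a \<and> (\<forall>b\<in>T. a \<subseteq>* b))"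

definition tower_number :: "nat set rel" ("\<tt>") where
  "\<tt> = min_card tower"

end

theory Submission
  imports Defs
begin

text \<open>
  Coding a point \<open>x\<close> by \<open>{m. x \<in> U m}\<close> turns a countable \<open>\<tau>\<close>-cover into a family of infinite sets
  linearly quasiordered by \<open>\<subseteq>*\<close>, and a \<open>\<gamma>\<close>-subcover into a pseudo-intersection of that family.

  Lower bound: let \<open>X\<close> be the union of fewer than \<open>\<tt>\<close> spaces \<open>X i\<close> in the class, and fix a \<open>\<tau>\<close>-cover
  of \<open>X\<close>. If the codes of some \<open>X i\<close> are coinitial among all codes, a pseudo-intersection on \<open>X i\<close>
  works on all of \<open>X\<close>. Otherwise every \<open>X i\<close> has a lower bound \<open>y i\<close> in \<open>X\<close>, and fewer than \<open>\<tt>\<close> codes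
  of points \<open>y i\<close> have a pseudo-intersection. So the given \<open>\<tau>\<close>-covers may be replaced by
  \<open>\<gamma>\<close>-covers. The selections made for the individual \<open>X i\<close> are then functions on the natural
  numbers, and fewer than \<open>\<tt>\<close> of these are eventually dominated by a single one, because \<open>\<tt>\<close> is
  at most the bounding number.

  Upper bound: a tower of size \<open>\<tt>\<close>, viewed as a set of reals, is not in the class, the witnessing
  cover being \<open>{a. n \<in> a}\<close> for the natural numbers \<open>n\<close>; and it is a union of \<open>\<tt>\<close> countably
  infinite sets, which are in the class.
\<close>

section \<open>Towers\<close>

text \<open>Towers without the clause that excludes pseudo-intersections: the shape of the family of
  codes of a \<tau>-cover.\<close>

definition star_chain :: "nat set set \<Rightarrow> bool" where
  "star_chain T \<longleftrightarrow> (\<forall>a\<in>T. infinite a) \<and> (\<forall>a\<in>T. \<forall>b\<in>T. a \<subseteq>* b \<or> b \<subseteq>* a)"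

lemma tower_iff: "tower T \<longleftrightarrow> star_chain T \<and> \<not> (\<exists>a. infinite a \<and> (\<forall>b\<in>T. a \<subseteq>* b))"
  unfolding tower_def star_chain_def by blast

lemma almost_subset_refl: "a \<subseteq>* a"
  by (simp add: almost_subset_def)

lemma almost_subset_if_subset: "a \<subseteq> b \<Longrightarrow> a \<subseteq>* b"
  by (simp add: almost_subset_def Diff_eq_empty_iff[THEN iffD2])

lemma almost_subset_trans:
  assumes "a \<subseteq>* b" "b \<subseteq>* c" shows "a \<subseteq>* c"
proof -
  have "a - c \<subseteq> (a - b) \<union> (b - c)" by blast
  then show ?thesis
    using assms unfolding almost_subset_def by (meson finite_UnI finite_subset)
qed

lemma star_chain_finite_least:
  assumes "finite T" "T \<noteq> {}" "star_chain T"
  shows "\<exists>a\<in>T. \<forall>b\<in>T. a \<subseteq>* b"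
  using assms
proof (induction rule: finite_ne_induct)
  case (singleton x)
  then show ?case by (simp add: almost_subset_refl)
next
  case (insert x F)
  then have "star_chain F"
    unfolding star_chain_def by simp
  then obtain a where a: "a \<in> F" "\<forall>b\<in>F. a \<subseteq>* b"
    using insert.IH by blast
  from insert.prems a(1) consider "a \<subseteq>* x" | "x \<subseteq>* a"
    unfolding star_chain_def by blast
  then show ?case
    by cases (use a almost_subset_trans almost_subset_refl in blast)+
qed

text \<open>The almost least member loses only finitely many elements to each of the others; the
  rest of it lies in all of them.\<close>

lemma star_chain_finite_Inter:
  assumes "finite T" "star_chain T"
  shows "infinite (\<Inter>T)"
proof (cases "T = {}")
  case True
  then show ?thesis by simp
next
  case False
  then obtain a where a: "a \<in> T" "\<forall>b\<in>T. a \<subseteq>* b"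
    using star_chain_finite_least assms by blast
  have "finite (\<Union>b\<in>T. a - b)"
    using assms(1) a(2) unfolding almost_subset_def by blast
  moreover have "infinite a"
    using a(1) assms(2) unfolding star_chain_def by blast
  ultimately have "infinite (a - (\<Union>b\<in>T. a - b))"
    by simp
  moreover have "a - (\<Union>b\<in>T. a - b) \<subseteq> \<Inter>T"
    by blast
  ultimately show ?thesis
    using finite_subset by blast
qed

lemma infinite_tower:
  assumes "tower T" shows "infinite T"
proof
  assume "finite T"
  then have "infinite (\<Inter>T)"
    using assms star_chain_finite_Inter tower_iff by blast
  moreover have "\<forall>b\<in>T. \<Inter>T \<subseteq>* b"
    by (simp add: Inter_lower almost_subset_if_subset)
  ultimately show False
    using assms unfolding tower_iff by blast
qed

text \<open>A maximal chain of infinite sets is a tower: half of a pseudo-intersection would still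
  lie below every member and so extend the chain.\<close>

lemma tower_exists: "\<exists>T. tower T"
proof -
  interpret pred_on "{a. infinite a}" "(\<subseteq>*)" .
  obtain C where C: "maxchain C"
    using Hausdorff by blast
  then have "star_chain C"
    unfolding star_chain_def maxchain_def chain_def
    using almost_subset_refl by blast
  moreover have False if a: "infinite a" "\<forall>b\<in>C. a \<subseteq>* b" for a
  proof -
    obtain a' b' where "a' \<subseteq> a" "b' \<subseteq> a" "infinite a'" "infinite b'" "a' \<inter> b' = {}"
      using infinite_split[OF a(1)] by blast
    then have a': "a' \<subseteq> a" "infinite a'" "infinite (a - a')"
      using finite_subset[of b' "a - a'"] by blast+
    have "a' \<subseteq>* b" if "b \<in> C" for b
      using that a a' almost_subset_trans almost_subset_if_subset by blast
    \<comment> \<open>Maximality forces \<open>a'\<close> into \<open>C\<close>, so \<open>a\<close>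
      is almost contained in its own half \<open>a'\<close>, although \<open>a - a'\<close> is
      infinite.\<close>
    then have "chain (insert a' C)"
      using C a'(2) unfolding maxchain_def chain_def by blast
    then have "a' \<in> C"
      using C unfolding maxchain_def by blast
    then show False
      using a(2) a'(3) unfolding almost_subset_def by blast
  qed
  ultimately show ?thesis
    unfolding tower_iff by blast
qed

lemma tower_number_attained_least:
  "\<exists>T. tower T \<and> \<tt> = |T| \<and> (\<forall>S. tower S \<longrightarrow> \<tt> \<le>o |S| )"
proof -
  obtain T where "tower T"
    using tower_exists by blast
  then show ?thesis
    unfolding tower_number_def by (rule min_card_attained_least)
qed

lemma pseudo_intersection_if_less_tower_number:
  assumes "|I| <o \<tt>" "star_chain (h ` I)"
  shows "\<exists>A. infinite A \<and> (\<forall>i\<in>I. A \<subseteq>* h i)"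
proof -
  have "|h ` I| <o \<tt>"
    using assms(1) card_of_image ordLeq_ordLess_trans by blast
  then have "\<not> tower (h ` I)"
    using tower_number_attained_least not_ordLess_ordLeq by blast
  then show ?thesis
    using assms(2) unfolding tower_iff by blast
qed

section \<open>Domination of fewer than \<open>\<tt>\<close> functions\<close>

lemma sparse_infinite_subset:
  fixes f :: "nat \<Rightarrow> nat"
  assumes "infinite A"
  obtains B where "infinite B" "B \<subseteq> A" "\<And>a b n. a \<in> B \<Longrightarrow> b \<in> B \<Longrightarrow> n \<le> a \<Longrightarrow> a < b \<Longrightarrow> f n < b"
proof -
  have "\<exists>s :: nat \<Rightarrow> nat. \<forall>k. s k \<in> A \<and> (s k < s (Suc k) \<and> (\<forall>n\<le>s k. f n < s (Suc k)))"
  proof (rule dependent_nat_choice)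
    show "\<exists>x. x \<in> A"
      using infinite_imp_nonempty[OF assms] by blast
  next
    fix x :: nat
    \<comment> \<open>The summand \<open>x\<close> makes the sequence increase, the maximum makes it
      outgrow \<open>f\<close> on all arguments up to \<open>x\<close>.\<close>
    obtain y where y: "y \<in> A" "x + Max (f ` {..x}) < y"
      using assms unfolding infinite_nat_iff_unbounded by blast
    have "f n < y" if "n \<le> x" for n
    proof -
      have "f n \<le> Max (f ` {..x})"
        using that by simp
      then show ?thesis
        using y(2) by linarith
    qed
    then show "\<exists>y. y \<in> A \<and> (x < y \<and> (\<forall>n\<le>x. f n < y))"
      using y by (intro exI[of _ y]) auto
  qed
  then obtain s where s: "\<And>k. s k \<in> A" "\<And>k. s k < s (Suc k)" "\<And>k n. n \<le> s k \<Longrightarrow> f n < s (Suc k)"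
    by blast
  have mono: "strict_mono s"
    using s(2) by (simp add: strict_mono_Suc_iff)
  show thesis
  proof (rule that[of "range s"])
    show "infinite (range s)"
      using mono range_inj_infinite strict_mono_imp_inj_on by blast
    show "range s \<subseteq> A"
      using s(1) by blast
    fix a b n assume "a \<in> range s" "b \<in> range s" "n \<le> a" "a < b"
    then obtain i j where ij: "a = s i" "b = s j" "i < j"
      using mono strict_mono_less by blast
    then have "s (Suc i) \<le> b"
      using mono by (simp add: Suc_leI strict_mono_less_eq)
    then show "f n < b"
      using s(3) ij(1) \<open>n \<le> a\<close> by fastforce
  qed
qed

text \<open>Along a well-order of \<open>I\<close> choose a \<open>\<subseteq>*\<close>-decreasing sequence of sets, the \<open>i\<close>-th so sparse
  that the second next element after \<open>n\<close> exceeds \<open>f i n\<close>; the second next element function of a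
  pseudo-intersection then dominates every \<open>f i\<close>.\<close>

lemma bounded_if_less_tower_number:
  fixes f :: "'i \<Rightarrow> nat \<Rightarrow> nat"
  assumes "|I| <o \<tt>"
  shows "\<exists>g. \<forall>i\<in>I. finite {n. g n < f i n}"
proof -
  \<comment> \<open>The cardinal \<open>|I|\<close> is itself a well-order of \<open>I\<close>;
    without its diagonal it supports well-founded recursion.\<close>
  define r where "r = |I| - Id"
  have wo: "Well_order |I|" "Field |I| = I"
    using card_of_well_order_on by (simp_all add: Field_card_of)
  have wf: "wf r"
    using wo(1) unfolding r_def well_order_on_def by blast
  have r_total: "(i, j) \<in> r \<or> (j, i) \<in> r" if "i \<in> I" "j \<in> I" "i \<noteq> j" for i j
    using wo that unfolding r_def well_order_on_def linear_order_on_def total_on_def by auto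
  have r_Field: "i \<in> I" if "(i, j) \<in> r" for i j
    using that wo(2) unfolding r_def Field_def by blast
  define P where "P T i A \<longleftrightarrow> infinite A \<and> (\<forall>j. (j, i) \<in> r \<longrightarrow> A \<subseteq>* T j) \<and>
      (\<forall>a\<in>A. \<forall>b\<in>A. \<forall>n. n \<le> a \<longrightarrow> a < b \<longrightarrow> f i n < b)" for T :: "'i \<Rightarrow> nat set" and i A
  have "\<exists>T. \<forall>i. P T i (T i)"
  proof (rule dependent_wf_choice[OF wf])
    show "P T i A = P S i A" if "\<And>j. (j, i) \<in> r \<Longrightarrow> T j = S j" for T S i A
      using that unfolding P_def by simp
  next
    fix i and T :: "'i \<Rightarrow> nat set" assume IH: "\<And>j. (j, i) \<in> r \<Longrightarrow> P T j (T j)"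
    define J where "J = {j. (j, i) \<in> r}"
    have J: "J \<subseteq> I"
      unfolding J_def using r_Field by blast
    have "|J| <o \<tt>"
      using J assms card_of_mono1 ordLeq_ordLess_trans by blast
    moreover have "star_chain (T ` J)"
    proof -
      have "T j \<subseteq>* T k \<or> T k \<subseteq>* T j" if "j \<in> J" "k \<in> J" for j k
        using that J IH r_total[of j k] almost_subset_refl unfolding P_def J_def by blast
      then show ?thesis
        using IH unfolding star_chain_def P_def J_def by blast
    qed
    ultimately obtain A where A: "infinite A" "\<forall>j\<in>J. A \<subseteq>* T j"
      using pseudo_intersection_if_less_tower_number by blast
    obtain B where "infinite B" "B \<subseteq> A" "\<And>a b n. a \<in> B \<Longrightarrow> b \<in> B \<Longrightarrow> n \<le> a \<Longrightarrow> a < b \<Longrightarrow> f i n < b"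
      using sparse_infinite_subset[OF A(1)] by metis
    then have "P T i B"
      unfolding P_def using A(2) almost_subset_trans almost_subset_if_subset
      unfolding J_def by blast
    then show "\<exists>B. P T i B" ..
  qed
  then obtain T where T: "\<And>i. P T i (T i)"
    by blast
  have "T i \<subseteq>* T j \<or> T j \<subseteq>* T i" if "i \<in> I" "j \<in> I" for i j
    using that T r_total[of i j] almost_subset_refl unfolding P_def by blast
  then have "star_chain (T ` I)"
    using T unfolding star_chain_def P_def by blast
  from pseudo_intersection_if_less_tower_number[OF assms this] obtain A
    where A: "infinite A" "\<forall>i\<in>I. A \<subseteq>* T i"
    by blast
  \<comment> \<open>Sparseness bounds \<open>f i n\<close> by the larger of two elements that are at
    least \<open>n\<close>, hence the intermediate \<open>a\<close>.\<close>
  have "\<exists>b. \<exists>a\<in>A. b \<in> A \<and> n \<le> a \<and> a < b" for n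
    using A(1) unfolding infinite_nat_iff_unbounded_le by (meson Suc_le_eq)
  then obtain g where g: "\<And>n. \<exists>a\<in>A. g n \<in> A \<and> n \<le> a \<and> a < g n"
    by metis
  show ?thesis
  proof (intro exI ballI)
    fix i assume "i \<in> I"
    then have "finite (A - T i)"
      using A(2) unfolding almost_subset_def by blast
    then obtain k where k: "\<And>m. m \<in> A - T i \<Longrightarrow> m < k"
      unfolding finite_nat_set_iff_bounded by blast
    have "f i n \<le> g n" if "n \<ge> k" for n
    proof -
      obtain a where a: "a \<in> A" "g n \<in> A" "n \<le> a" "a < g n"
        using g by blast
      then have "a \<in> T i" "g n \<in> T i"
        using k that by force+
      then show ?thesis
        using a T[of i] unfolding P_def by fastforce
    qed
    then have "{n. g n < f i n} \<subseteq> {..<k}"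
      by (force simp: not_less[symmetric])
    then show "finite {n. g n < f i n}"
      using finite_subset by blast
  qed
qed

section \<open>The selection principle for indexed covers\<close>

lemma sym_diff_singleton_inj: "sym_diff U {x} = sym_diff U {y} \<Longrightarrow> x = y"
  by blast

text \<open>Restricting a cover to a subspace can identify its members or turn them into the whole
  subspace. Changing each member at one point of its own repairs both, and affects the code of
  every point at one index only.\<close>

lemma distinct_perturbation:
  fixes U :: "nat \<Rightarrow> 'a set"
  assumes "infinite X"
  obtains x where "inj x" "range x \<subseteq> X" "inj (\<lambda>k. sym_diff (U k) {x k})" "\<And>k. sym_diff (U k) {x k} \<noteq> X"
proof -
  define P where "P x k y \<longleftrightarrow> y \<in> X \<and> sym_diff (U k) {y} \<noteq> X \<and>
      (\<forall>j<k. y \<noteq> x j \<and> sym_diff (U k) {y} \<noteq> sym_diff (U j) {x j})" for x :: "nat \<Rightarrow> 'a" and k y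
  have "\<exists>x. \<forall>k. P x k (x k)"
  proof (rule dependent_wf_choice[OF wf_less_than])
    show "P x k y = P z k y" if "\<And>j. (j, k) \<in> less_than \<Longrightarrow> x j = z j" for x z k y
      using that unfolding P_def by simp
  next
    fix k and x :: "nat \<Rightarrow> 'a"
    \<comment> \<open>Since \<open>sym_diff (U k) {y}\<close> determines \<open>y\<close>, every
      forbidden set rules out at most one point, and stage \<open>k\<close> has finitely many
      restrictions.\<close>
    have fin: "finite {y. sym_diff (U k) {y} = V}" for V
      by (rule finite_subset[of _ "{THE y. sym_diff (U k) {y} = V}"])
        (auto intro!: the_equality[symmetric] dest: sym_diff_singleton_inj simp del: Diff_insert0)
    have "finite ({y. sym_diff (U k) {y} = X} \<union>
        (\<Union>j<k. insert (x j) {y. sym_diff (U k) {y} = sym_diff (U j) {x j}}))"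
      (is "finite ?Z") using fin by simp
    then have "infinite (X - ?Z)"
      using assms by (rule Diff_infinite_finite)
    then obtain y where "y \<in> X - ?Z"
      using infinite_imp_nonempty by blast
    then have "P x k y"
      unfolding P_def by simp
    then show "\<exists>y. P x k y" ..
  qed
  then obtain x where x: "\<And>k. P x k (x k)"
    by blast
  show thesis
  proof (rule that)
    show "inj x"
      using x unfolding P_def by (metis injI linorder_neqE_nat)
    show "inj (\<lambda>k. sym_diff (U k) {x k})"
      using x unfolding P_def by (metis (no_types, lifting) injI linorder_neqE_nat)
  qed (use x in \<open>auto simp: P_def\<close>)
qed

definition tau_indexed :: "'a set \<Rightarrow> (nat \<Rightarrow> 'a set) \<Rightarrow> bool" where
  "tau_indexed X B \<longleftrightarrow> star_chain ((\<lambda>x. {m. x \<in> B m}) ` X)"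

text \<open>The selection principle for sequences of Borel sets of reals instead of sets of traces.
  Repetitions and members containing \<open>X\<close> are allowed, so covers can be restricted,
  shifted and intersected freely.\<close>

definition tau_gamma :: "'a::topological_space set \<Rightarrow> bool" where
  "tau_gamma X \<longleftrightarrow> (\<forall>B. (\<forall>n. tau_indexed X (B n)) \<longrightarrow> (\<forall>n m. B n m \<in> sets borel) \<longrightarrow>
     (\<exists>f :: nat \<Rightarrow> nat. \<forall>x\<in>X. finite {n. x \<notin> B n (f n)}))"

lemma tau_gammaD:
  assumes "tau_gamma X" "\<And>n. tau_indexed X (B n)" "\<And>n m. B n m \<in> sets borel"
  shows "\<exists>f :: nat \<Rightarrow> nat. \<forall>x\<in>X. finite {n. x \<notin> B n (f n)}"
  using assms unfolding tau_gamma_def by simp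

lemma tau_indexed_altdef:
  "tau_indexed X B \<longleftrightarrow> (\<forall>x\<in>X. infinite {m. x \<in> B m}) \<and>
     (\<forall>x\<in>X. \<forall>y\<in>X. finite {m. x \<in> B m \<and> y \<notin> B m} \<or> finite {m. y \<in> B m \<and> x \<notin> B m})"
proof -
  have "{m. x \<in> B m} - {m. y \<in> B m} = {m. x \<in> B m \<and> y \<notin> B m}" for x y
    by blast
  then show ?thesis
    unfolding tau_indexed_def star_chain_def almost_subset_def by simp
qed

lemma tau_indexed_mono: "tau_indexed X B \<Longrightarrow> Y \<subseteq> X \<Longrightarrow> tau_indexed Y B"
  unfolding tau_indexed_def star_chain_def by blast

text \<open>The indexed form of the fact that \<gamma>-covers are \<tau>-covers: a cofinite code
  almost contains every other code.\<close>

lemma tau_indexed_cofinite: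
  assumes "\<And>x. x \<in> X \<Longrightarrow> finite {m. x \<notin> B m}"
  shows "tau_indexed X B"
proof -
  have "infinite {m. x \<in> B m}" if "x \<in> X" for x
  proof
    assume "finite {m. x \<in> B m}"
    then have "finite ({m. x \<in> B m} \<union> {m. x \<notin> B m})"
      using assms[OF that] by blast
    moreover have "{m. x \<in> B m} \<union> {m. x \<notin> B m} = UNIV" by blast
    ultimately show False by simp
  qed
  moreover have "finite {m. x \<in> B m \<and> y \<notin> B m}" if "y \<in> X" for x y
    by (rule finite_subset[OF _ assms[OF that]]) blast
  ultimately show ?thesis
    unfolding tau_indexed_altdef by blast
qed

lemma finite_Collect_range_inj_iff:
  assumes "inj V"
  shows "finite {U \<in> range V. P U} \<longleftrightarrow> finite {m. P (V m)}"
proof -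
  have "{U \<in> range V. P U} = V ` {m. P (V m)}" by blast
  then show ?thesis
    using assms finite_image_iff inj_on_subset by (metis subset_UNIV)
qed

text \<open>Injectivity equates counting members with counting indices; that the sets cover
  \<open>X\<close> follows from the codes being nonempty.\<close>

lemma tau_cover_range_iff:
  assumes "inj V" "range V \<subseteq> Pow X" "X \<notin> range V"
  shows "tau_cover X (range V) \<longleftrightarrow> tau_indexed X V"
proof -
  have "\<Union>(range V) = X" if "\<forall>x\<in>X. infinite {m. x \<in> V m}"
  proof
    show "X \<subseteq> \<Union>(range V)"
    proof
      fix x assume "x \<in> X"
      then have "{m. x \<in> V m} \<noteq> {}"
        using that infinite_imp_nonempty by blast
      then show "x \<in> \<Union>(range V)" by blast
    qed
  qed (use assms(2) in blast)
  then show ?thesis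
    using assms(2,3)
    unfolding tau_cover_def large_cover_def cover_def tau_indexed_altdef
      finite_Collect_range_inj_iff[OF assms(1)] not_imp
    by blast
qed

lemma finite_sym_diff_inj_singleton:
  assumes "inj x"
  shows "finite {k. y \<in> sym_diff (U k) {x k} \<longleftrightarrow> y \<notin> U k}"
proof -
  have "{k. y \<in> sym_diff (U k) {x k} \<longleftrightarrow> y \<notin> U k} = x -` {y}"
    by auto
  then show ?thesis
    using assms by (simp add: finite_vimageI)
qed

lemma tau_indexed_cong_cofinite:
  assumes "tau_indexed X B" "\<And>x. x \<in> X \<Longrightarrow> finite {k. x \<in> C k \<longleftrightarrow> x \<notin> B k}"
  shows "tau_indexed X C"
proof -
  have "infinite {m. x \<in> C m}" if "x \<in> X" for x
  proof
    assume "finite {m. x \<in> C m}"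
    then have "finite ({m. x \<in> C m} \<union> {k. x \<in> C k \<longleftrightarrow> x \<notin> B k})"
      using assms(2)[OF that] by blast
    then have "finite {m. x \<in> B m}"
      by (rule rev_finite_subset) blast
    then show False
      using assms(1) that unfolding tau_indexed_altdef by blast
  qed
  moreover have "finite {m. x \<in> C m \<and> y \<notin> C m}"
    if "x \<in> X" "y \<in> X" "finite {m. x \<in> B m \<and> y \<notin> B m}" for x y
  proof -
    have "finite ({m. x \<in> B m \<and> y \<notin> B m} \<union> {k. x \<in> C k \<longleftrightarrow> x \<notin> B k} \<union> {k. y \<in> C k \<longleftrightarrow> y \<notin> B k})"
      using assms(2) that by blast
    then show ?thesis
      by (rule rev_finite_subset) blast
  qed
  ultimately show ?thesis
    using assms(1) unfolding tau_indexed_altdef by blast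
qed

text \<open>The selected sets may repeat, but one selected infinitely often would contain every
  point and thus equal \<open>X\<close>. Hence the range is infinite.\<close>

lemma gamma_cover_choice:
  assumes "range U \<subseteq> Pow X" "X \<notin> range U" "infinite X" "\<And>x. x \<in> X \<Longrightarrow> finite {n :: nat. x \<notin> U n}"
  shows "gamma_cover X (range U)"
proof -
  have "infinite (range U)"
  proof
    assume "finite (range U)"
    then obtain k where k: "infinite {n. U n = U k}"
      using pigeonhole_infinite[of UNIV U] by auto
    have "x \<in> U k" if "x \<in> X" for x
    proof (rule ccontr)
      assume "x \<notin> U k"
      then have "{n. U n = U k} \<subseteq> {n. x \<notin> U n}" by blast
      then show False
        using k assms(4)[OF that] finite_subset by blast
    qed
    then have "U k = X" using assms(1) by blast
    then show False using assms(2) by blast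
  qed
  moreover have "finite {V \<in> range U. x \<notin> V}" if "x \<in> X" for x
  proof -
    have "{V \<in> range U. x \<notin> V} = U ` {n. x \<notin> U n}" by blast
    then show ?thesis using assms(4)[OF that] by simp
  qed
  moreover have "X \<subseteq> \<Union>(range U)"
  proof
    fix x assume "x \<in> X"
    then have "\<exists>n. x \<in> U n"
      using assms(4)[of x] by (metis (mono_tags, lifting) Collect_cong UNIV_def infinite_UNIV_nat)
    then show "x \<in> \<Union>(range U)" by blast
  qed
  ultimately show ?thesis
    using assms(1,2) unfolding gamma_cover_def cover_def by blast
qed

section \<open>Equivalence of the class with the indexed principle\<close>

lemma S1_if_tau_gamma:
  assumes "infinite X" "tau_gamma X"
  shows "X \<in> S1 B_Tau B_Gamma"
proof -
  have "\<exists>U. (\<forall>n. U n \<in> \<U> n) \<and> range U \<in> B_Gamma X"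
    if \<U>: "\<And>n. \<U> n \<in> B_Tau X" for \<U> :: "nat \<Rightarrow> real set set"
  proof -
    have cov: "countable (\<U> n)" "\<U> n \<subseteq> sets (restrict_space borel X)" "tau_cover X (\<U> n)" for n
      using \<U> unfolding B_Tau_def countable_borel_def by blast+
    have sub: "\<U> n \<subseteq> Pow X" "X \<notin> \<U> n" for n
      using cov(3) unfolding tau_cover_def large_cover_def cover_def by blast+
    \<comment> \<open>Infinitude comes from largeness at a single point; it allows an injective
      enumeration by all natural numbers.\<close>
    have inf: "infinite (\<U> n)" for n
    proof -
      obtain x where "x \<in> X"
        using assms(1) infinite_imp_nonempty by blast
      then have "infinite {U \<in> \<U> n. x \<in> U}"
        using cov(3) unfolding tau_cover_def large_cover_def by blast
      then show ?thesis
        using finite_subset[of "{U \<in> \<U> n. x \<in> U}"] by blast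
    qed
    define V where "V n = from_nat_into (\<U> n)" for n
    have V: "inj (V n)" "range (V n) = \<U> n" for n
      using bij_betw_from_nat_into[OF cov(1) inf] unfolding V_def bij_betw_def by blast+
    have "\<exists>B\<in>sets borel. V n m = X \<inter> B" for n m
    proof -
      have "V n m \<in> sets (restrict_space borel X)"
        using cov(2) V(2) by blast
      then show ?thesis unfolding sets_restrict_space by blast
    qed
    then obtain B where B: "\<And>n m. B n m \<in> sets borel" "\<And>n m. V n m = X \<inter> B n m"
      by metis
    have tau: "tau_indexed X (B n)" for n
    proof -
      have "tau_indexed X (V n)"
        using tau_cover_range_iff[OF V(1)] cov(3) sub V(2) by metis
      then show ?thesis
        by (rule tau_indexed_cong_cofinite) (simp add: B(2))
    qed
    obtain f where f: "\<forall>x\<in>X. finite {n. x \<notin> B n (f n)}"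
      using tau_gammaD[of X B, OF assms(2) tau B(1)] by blast
    define U where "U n = V n (f n)" for n
    have mem: "U n \<in> \<U> n" for n
      unfolding U_def using V(2) by blast
    have "gamma_cover X (range U)"
    proof (rule gamma_cover_choice)
      show "finite {n. x \<notin> U n}" if "x \<in> X" for x
        using f that unfolding U_def B(2) by simp
      show "range U \<subseteq> Pow X"
        using mem sub(1) by blast
      show "X \<notin> range U"
        using mem sub(2) by blast
    qed (rule assms(1))
    moreover have "countable_borel X (range U)"
      unfolding countable_borel_def using mem cov(2) by blast
    ultimately show ?thesis
      using mem unfolding B_Gamma_def by blast
  qed
  then show ?thesis
    using assms(1) unfolding S1_def selects1_def by blast
qed

lemma tau_gamma_if_S1:
  assumes "X \<in> S1 B_Tau B_Gamma"
  shows "tau_gamma X"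
  unfolding tau_gamma_def
proof (intro allI impI)
  fix B :: "nat \<Rightarrow> nat \<Rightarrow> real set"
  assume tau: "\<forall>n. tau_indexed X (B n)" and borel: "\<forall>n m. B n m \<in> sets borel"
  have X: "infinite X" "selects1 (B_Tau X) (B_Gamma X)"
    using assms unfolding S1_def by blast+
  \<comment> \<open>All pairs \<open>(n, m)\<close> are perturbed at once through
    \<open>prod_decode\<close>, so the sets become distinct across different covers as well as
    within each.\<close>
  obtain x where x: "inj x" "range x \<subseteq> X"
      "inj (\<lambda>k. sym_diff (case_prod B (prod_decode k) \<inter> X) {x k})"
      "\<And>k. sym_diff (case_prod B (prod_decode k) \<inter> X) {x k} \<noteq> X"
    using distinct_perturbation[OF X(1), of "\<lambda>k. case_prod B (prod_decode k) \<inter> X"] by blast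
  define V where "V n m = sym_diff (B n m \<inter> X) {x (prod_encode (n, m))}" for n m
  have V_eq: "V n m = sym_diff (case_prod B (prod_decode (prod_encode (n, m))) \<inter> X)
      {x (prod_encode (n, m))}" for n m
    by (simp add: V_def)
  have V_inj: "n = n' \<and> m = m'" if "V n m = V n' m'" for n m n' m'
    using injD[OF x(3), of "prod_encode (n, m)" "prod_encode (n', m')"] that
    unfolding V_eq by simp
  have V_ne: "V n m \<noteq> X" for n m
    unfolding V_eq by (rule x(4))
  have V_sub: "V n m \<subseteq> X" for n m
    using x(2) unfolding V_def by blast
  have V_borel: "V n m \<in> sets (restrict_space borel X)" for n m
  proof -
    have "V n m = X \<inter> sym_diff (B n m) {x (prod_encode (n, m))}"
      using x(2) unfolding V_def by blast
    moreover have "sym_diff (B n m) {x (prod_encode (n, m))} \<in> sets borel"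
      using borel by (intro sets.Un sets.Diff) auto
    ultimately show ?thesis
      unfolding sets_restrict_space by blast
  qed
  have "range (V n) \<in> B_Tau X" for n
  proof -
    have "inj (V n)"
      using V_inj by (meson injI)
    moreover have "tau_indexed X (V n)"
    proof (rule tau_indexed_cong_cofinite)
      show "tau_indexed X (B n)" using tau by blast
      fix y assume y: "y \<in> X"
      have "inj (\<lambda>m. x (prod_encode (n, m)))"
        by (rule injI) (simp add: inj_eq[OF x(1)])
      from finite_sym_diff_inj_singleton[OF this, of y "\<lambda>m. B n m \<inter> X"]
      show "finite {m. y \<in> V n m \<longleftrightarrow> y \<notin> B n m}"
        unfolding V_def using y by simp
    qed
    ultimately have "tau_cover X (range (V n))"
      using tau_cover_range_iff V_sub V_ne by (metis (no_types, lifting) PowI image_subsetI rangeE)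
    then show ?thesis
      unfolding B_Tau_def countable_borel_def using V_borel by auto
  qed
  then obtain U where U: "\<And>n. U n \<in> range (V n)" "range U \<in> B_Gamma X"
    using X(2)[unfolded selects1_def, rule_format, of "\<lambda>n. range (V n)"] by blast
  have "\<forall>n. \<exists>m. U n = V n m"
    using U(1) by blast
  from choice[OF this] obtain f where f: "\<And>n. U n = V n (f n)"
    by blast
  have "finite {n. y \<notin> B n (f n)}" if y: "y \<in> X" for y
  proof -
    \<comment> \<open>The \<gamma>-cover condition counts sets in \<open>range U\<close>.
      Distinctness across covers turns finitely many sets omitting \<open>y\<close> into finitely
      many \<open>n\<close>.\<close>
    have "inj U"
      by (rule injI, unfold f) (use V_inj in blast)
    moreover have "finite {W \<in> range U. y \<notin> W}"
      using U(2) y unfolding B_Gamma_def gamma_cover_def by blast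
    ultimately have "finite {n. y \<notin> V n (f n)}"
      using finite_Collect_range_inj_iff[of U "\<lambda>W. y \<notin> W"] by (simp add: f)
    moreover have "inj (\<lambda>n. x (prod_encode (n, f n)))"
      by (rule injI) (simp add: inj_eq[OF x(1)])
    from finite_sym_diff_inj_singleton[OF this, of y "\<lambda>n. B n (f n) \<inter> X"]
    have "finite {n. y \<in> V n (f n) \<longleftrightarrow> y \<notin> B n (f n)}"
      unfolding V_def using y by simp
    ultimately have "finite ({n. y \<notin> V n (f n)} \<union> {n. y \<in> V n (f n) \<longleftrightarrow> y \<notin> B n (f n)})"
      by blast
    then show ?thesis
      by (rule rev_finite_subset) blast
  qed
  then show "\<exists>f. \<forall>x\<in>X. finite {n. x \<notin> B n (f n)}" by blast
qed

lemma S1_B_Tau_B_Gamma_iff: "X \<in> S1 B_Tau B_Gamma \<longleftrightarrow> infinite X \<and> tau_gamma X"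
  using S1_if_tau_gamma tau_gamma_if_S1 unfolding S1_def by blast

section \<open>Unions of fewer than \<open>\<tt>\<close> spaces\<close>

lemma finite_Collect_add_iff: "finite {m :: nat. P (n + m)} \<longleftrightarrow> finite {m. P m}"
proof
  assume "finite {m. P (n + m)}"
  then have "finite ({..<n} \<union> (+) n ` {m. P (n + m)})"
    by simp
  moreover have "{m. P m} \<subseteq> {..<n} \<union> (+) n ` {m. P (n + m)}"
  proof
    fix m assume "m \<in> {m. P m}"
    then show "m \<in> {..<n} \<union> (+) n ` {m. P (n + m)}"
      by (cases "m < n") (auto simp: image_iff intro!: exI[of _ "m - n"])
  qed
  ultimately show "finite {m. P m}"
    using finite_subset by blast
next
  assume "finite {m. P m}"
  then have "finite ((+) n -` {m. P m})"
    by (intro finite_vimageI) auto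
  then show "finite {m. P (n + m)}"
    by (simp add: vimage_def)
qed

lemma tau_indexed_shift: "tau_indexed X B \<Longrightarrow> tau_indexed X (\<lambda>m. B (n + m))"
  using finite_Collect_add_iff[where P = "\<lambda>m. x \<in> B m" for x]
    finite_Collect_add_iff[where P = "\<lambda>m. x \<in> B m \<and> y \<notin> B m" for x y]
  unfolding tau_indexed_altdef by simp

lemma tau_gamma_pseudo_intersection:
  assumes "tau_gamma X" "tau_indexed X B" "\<And>m. B m \<in> sets borel"
  shows "\<exists>A. infinite A \<and> (\<forall>x\<in>X. A \<subseteq>* {m. x \<in> B m})"
proof -
  \<comment> \<open>For the constant sequence of covers \<open>B\<close> the selected indices might repeat.\<close>
  obtain f where f: "\<forall>x\<in>X. finite {n. x \<notin> B (n + f n)}"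
    using tau_gammaD[of X "\<lambda>n m. B (n + m)", OF assms(1) tau_indexed_shift[OF assms(2)] assms(3)]
    by blast
  have "infinite (range (\<lambda>n. n + f n))"
    unfolding infinite_nat_iff_unbounded_le by (metis le_add1 rangeI)
  moreover have "range (\<lambda>n. n + f n) \<subseteq>* {m. x \<in> B m}" if "x \<in> X" for x
  proof -
    have "range (\<lambda>n. n + f n) - {m. x \<in> B m} = (\<lambda>n. n + f n) ` {n. x \<notin> B (n + f n)}"
      by blast
    then show ?thesis
      unfolding almost_subset_def using f that by simp
  qed
  ultimately show ?thesis by blast
qed

lemma pseudo_intersection_Union:
  assumes I: "|I| <o \<tt>"
    and Y: "Y = (\<Union>i\<in>I. X i)"
    and pseudo: "\<And>i. i \<in> I \<Longrightarrow> \<exists>A. infinite A \<and> (\<forall>x\<in>X i. A \<subseteq>* h x)"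
    and chain: "star_chain (h ` Y)"
  shows "\<exists>A. infinite A \<and> (\<forall>x\<in>Y. A \<subseteq>* h x)"
proof (cases "\<exists>i\<in>I. \<forall>y\<in>Y. \<exists>x\<in>X i. h x \<subseteq>* h y")
  case True
  then obtain i where i: "i \<in> I" "\<forall>y\<in>Y. \<exists>x\<in>X i. h x \<subseteq>* h y"
    by blast
  obtain A where A: "infinite A" "\<forall>x\<in>X i. A \<subseteq>* h x"
    using pseudo[OF i(1)] by blast
  have "A \<subseteq>* h y" if "y \<in> Y" for y
  proof -
    obtain x where "x \<in> X i" "h x \<subseteq>* h y"
      using i(2) \<open>y \<in> Y\<close> by blast
    then show ?thesis
      using A(2) almost_subset_trans by blast
  qed
  then show ?thesis
    using A(1) by blast
next
  case False
  \<comment> \<open>Failure of coinitiality gives a code that no code from \<open>X i\<close> is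
    almost below; by linearity it is almost below all of them.\<close>
  then have "\<forall>i\<in>I. \<exists>y. y \<in> Y \<and> (\<forall>x\<in>X i. \<not> h x \<subseteq>* h y)"
    by blast
  from bchoice[OF this] obtain y
    where y: "\<And>i. i \<in> I \<Longrightarrow> y i \<in> Y" "\<And>i x. i \<in> I \<Longrightarrow> x \<in> X i \<Longrightarrow> \<not> h x \<subseteq>* h (y i)"
    by blast
  have "(\<lambda>i. h (y i)) ` I \<subseteq> h ` Y"
    using y(1) by blast
  then have "star_chain ((\<lambda>i. h (y i)) ` I)"
    using chain unfolding star_chain_def by (meson subsetD)
  from pseudo_intersection_if_less_tower_number[OF I this] obtain A
    where A: "infinite A" "\<forall>i\<in>I. A \<subseteq>* h (y i)"
    by blast
  have "A \<subseteq>* h x" if i: "i \<in> I" and x: "x \<in> X i" for i x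
  proof -
    have "h (y i) \<in> h ` Y" "h x \<in> h ` Y"
      using i x y(1)[OF i] unfolding Y by auto
    then have "h (y i) \<subseteq>* h x"
      using chain y(2)[OF i x] unfolding star_chain_def by blast
    then show ?thesis
      using A(2) i almost_subset_trans by blast
  qed
  then show ?thesis
    using A(1) unfolding Y by (intro exI[of _ A]) auto
qed

lemma tau_gamma_Union:
  fixes X :: "'i \<Rightarrow> 'a::topological_space set"
  assumes I: "|I| <o \<tt>" and X: "\<And>i. i \<in> I \<Longrightarrow> tau_gamma (X i)"
  shows "tau_gamma (\<Union>i\<in>I. X i)"
  unfolding tau_gamma_def
proof (intro allI impI)
  fix B :: "nat \<Rightarrow> nat \<Rightarrow> 'a set"
  assume tau: "\<forall>n. tau_indexed (\<Union>i\<in>I. X i) (B n)" and borel: "\<forall>n m. B n m \<in> sets borel"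
  have "\<exists>A. infinite A \<and> (\<forall>x\<in>(\<Union>i\<in>I. X i). A \<subseteq>* {m. x \<in> B n m})" for n
  proof (rule pseudo_intersection_Union[OF I refl])
    show "star_chain ((\<lambda>x. {m. x \<in> B n m}) ` (\<Union>i\<in>I. X i))"
      using tau unfolding tau_indexed_def by blast
    show "\<exists>A. infinite A \<and> (\<forall>x\<in>X i. A \<subseteq>* {m. x \<in> B n m})" if "i \<in> I" for i
    proof (rule tau_gamma_pseudo_intersection[OF X[OF that]])
      show "tau_indexed (X i) (B n)"
        by (rule tau_indexed_mono[OF spec[OF tau]]) (use that in blast)
    qed (use borel in blast)
  qed
  then have "\<forall>n. \<exists>A. infinite A \<and> (\<forall>x\<in>(\<Union>i\<in>I. X i). A \<subseteq>* {m. x \<in> B n m})"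
    by blast
  from choice[OF this] obtain A
    where A: "\<And>n. infinite (A n)" "\<And>n x. x \<in> (\<Union>i\<in>I. X i) \<Longrightarrow> A n \<subseteq>* {m. x \<in> B n m}"
    by blast
  \<comment> \<open>Decreasing the sets makes \<open>C n m\<close> increasing in \<open>m\<close>, so that larger selections stay correct.\<close>
  define C where "C n m = (\<Inter>k\<in>{m..}. B n (enumerate (A n) k))" for n m
  have C_mono: "x \<in> C n m'" if "x \<in> C n m" "m \<le> m'" for x n m m'
    using that unfolding C_def by auto
  have C_cofinite: "finite {m. x \<notin> C n m}" if x: "x \<in> (\<Union>i\<in>I. X i)" for x n
  proof -
    have "inj (enumerate (A n))"
      using strict_mono_enumerate[OF A(1)] strict_mono_imp_inj_on by blast
    then have "finite (enumerate (A n) -` (A n - {m. x \<in> B n m}))"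
      using A(2)[OF x] unfolding almost_subset_def by (rule finite_vimageI[rotated])
    then obtain k where k: "\<forall>j\<in>enumerate (A n) -` (A n - {m. x \<in> B n m}). j < k"
      unfolding finite_nat_set_iff_bounded by blast
    have "x \<in> B n (enumerate (A n) j)" if "k \<le> j" for j
      using bspec[OF k, of j] that enumerate_in_set[OF A(1), of n j] by auto
    then have C: "x \<in> C n m" if "k \<le> m" for m
      using that unfolding C_def by auto
    have "{m. x \<notin> C n m} \<subseteq> {..<k}"
      by (rule subsetI, rule ccontr) (use C in auto)
    then show ?thesis
      using finite_subset by blast
  qed
  \<comment> \<open>The hypothesis on \<open>X i\<close> is applied a second time, now to the sets
    \<open>C n m\<close>, for which every point has a cofinite code.\<close>
  have "\<exists>F. \<forall>x\<in>X i. finite {n. x \<notin> C n (F n)}" if i: "i \<in> I" for i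
  proof (rule tau_gammaD[OF X[OF i]])
    show "tau_indexed (X i) (C n)" for n
      by (rule tau_indexed_cofinite, rule C_cofinite) (use i in blast)
    show "C n m \<in> sets borel" for n m
      unfolding C_def using borel by (intro sets.countable_INT') auto
  qed
  then have "\<forall>i\<in>I. \<exists>F. \<forall>x\<in>X i. finite {n. x \<notin> C n (F n)}"
    by blast
  from bchoice[OF this] obtain F where F: "\<And>i x. i \<in> I \<Longrightarrow> x \<in> X i \<Longrightarrow> finite {n. x \<notin> C n (F i n)}"
    by blast
  obtain g where g: "\<forall>i\<in>I. finite {n. g n < F i n}"
    using bounded_if_less_tower_number[OF I, of F] by blast
  have "finite {n. x \<notin> B n (enumerate (A n) (g n))}" if i: "i \<in> I" and x: "x \<in> X i" for i x
  proof (rule finite_subset)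
    \<comment> \<open>Wherever \<open>F i n \<le> g n\<close>, monotonicity of \<open>C n\<close>
      carries membership from \<open>F i n\<close> to \<open>g n\<close>.\<close>
    show "{n. x \<notin> B n (enumerate (A n) (g n))} \<subseteq> {n. x \<notin> C n (F i n)} \<union> {n. g n < F i n}"
    proof
      fix n assume "n \<in> {n. x \<notin> B n (enumerate (A n) (g n))}"
      then have "x \<notin> C n (g n)"
        unfolding C_def by blast
      then show "n \<in> {n. x \<notin> C n (F i n)} \<union> {n. g n < F i n}"
        using C_mono[of x n "F i n" "g n"] by (cases "F i n \<le> g n") auto
    qed
    show "finite ({n. x \<notin> C n (F i n)} \<union> {n. g n < F i n})"
      using F[OF i x] g i by simp
  qed
  then show "\<exists>f. \<forall>x\<in>(\<Union>i\<in>I. X i). finite {n. x \<notin> B n (f n)}"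
    by (intro exI[of _ "\<lambda>n. enumerate (A n) (g n)"]) blast
qed

text \<open>Finitely many codes always meet, so the \<open>n\<close>-th selection can contain the
  points \<open>x 0\<close> to \<open>x n\<close>; then \<open>x i\<close> is missed only before
  stage \<open>i\<close>.\<close>

lemma tau_gamma_countable:
  assumes "countable X"
  shows "tau_gamma X"
proof (cases "X = {}")
  case True
  then show ?thesis by (simp add: tau_gamma_def)
next
  case False
  define x where "x = from_nat_into X"
  have x: "X = range x"
    unfolding x_def using False assms by (simp add: range_from_nat_into)
  show ?thesis
    unfolding tau_gamma_def
  proof (intro allI impI)
    fix B :: "nat \<Rightarrow> nat \<Rightarrow> 'a set"
    assume tau: "\<forall>n. tau_indexed X (B n)"
    have "\<exists>m. \<forall>i\<le>n. x i \<in> B n m" for n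
    proof -
      have "x ` {..n} \<subseteq> X"
        unfolding x by blast
      then have "star_chain ((\<lambda>y. {m. y \<in> B n m}) ` (x ` {..n}))"
        using tau tau_indexed_mono unfolding tau_indexed_def[symmetric] by blast
      then have "infinite (\<Inter>y\<in>x ` {..n}. {m. y \<in> B n m})"
        by (intro star_chain_finite_Inter) auto
      then obtain m where "m \<in> (\<Inter>y\<in>x ` {..n}. {m. y \<in> B n m})"
        using infinite_imp_nonempty by blast
      then show ?thesis by auto
    qed
    then have "\<forall>n. \<exists>m. \<forall>i\<le>n. x i \<in> B n m" by blast
    from choice[OF this] obtain f where f: "\<And>n i. i \<le> n \<Longrightarrow> x i \<in> B n (f n)"
      by blast
    have "finite {n. x i \<notin> B n (f n)}" for i
    proof (rule finite_subset)
      show "{n. x i \<notin> B n (f n)} \<subseteq> {..<i}"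
        by (rule subsetI, rule ccontr) (use f in auto)
    qed simp
    then show "\<exists>f. \<forall>y\<in>X. finite {n. y \<notin> B n (f n)}"
      unfolding x by blast
  qed
qed

section \<open>A tower as a set of reals\<close>

text \<open>In base 4 with digits 0 and 1 all tails are at most 1/3, so digits can be read off by \<open>frac\<close>.\<close>

definition quaternary :: "nat set \<Rightarrow> real" where
  "quaternary a = (\<Sum>n. of_bool (n \<in> a) * (1 / 4) ^ Suc n)"

lemma sums_third: "(\<lambda>n. (1 / 4 :: real) ^ Suc n) sums (1 / 3)"
  using sums_mult[OF geometric_sums[of "1 / 4 :: real"], of "1 / 4"] by simp

lemma summable_quaternary: "summable (\<lambda>n. of_bool (n \<in> a) * (1 / 4 :: real) ^ Suc n)"
  by (rule summable_comparison_test'[OF sums_summable[OF sums_third], of 0]) (auto simp: of_bool_def)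

lemma quaternary_bounds: "0 \<le> quaternary a" "quaternary a \<le> 1 / 3"
proof -
  show "0 \<le> quaternary a"
    unfolding quaternary_def by (rule suminf_nonneg[OF summable_quaternary]) simp
  have "quaternary a \<le> (\<Sum>n. (1 / 4) ^ Suc n)"
    unfolding quaternary_def
    by (rule suminf_le[OF _ summable_quaternary sums_summable[OF sums_third]]) (auto simp: of_bool_def)
  then show "quaternary a \<le> 1 / 3"
    using sums_unique[OF sums_third] by simp
qed

lemma quaternary_step: "4 * quaternary a = of_bool (0 \<in> a) + quaternary {n. Suc n \<in> a}"
proof -
  have "quaternary a = of_bool (0 \<in> a) / 4 + (\<Sum>n. of_bool (Suc n \<in> a) * (1 / 4) ^ Suc (Suc n))"
    using suminf_split_head[OF summable_quaternary[of a]] unfolding quaternary_def by simp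
  also have "(\<Sum>n. of_bool (Suc n \<in> a) * (1 / 4 :: real) ^ Suc (Suc n))
      = (\<Sum>n. 1 / 4 * (of_bool (n \<in> {n. Suc n \<in> a}) * (1 / 4) ^ Suc n))"
    by (simp add: mult_ac)
  also have "\<dots> = quaternary {n. Suc n \<in> a} / 4"
    using suminf_mult[OF summable_quaternary[of "{n. Suc n \<in> a}"], of "1 / 4"]
    unfolding quaternary_def by simp
  finally show ?thesis by simp
qed

text \<open>Multiplication by \<open>4 ^ n\<close> moves the first \<open>n\<close> digits into the
  integer part and leaves the tail.\<close>

lemma quaternary_shift: "4 ^ n * quaternary a - quaternary {k. n + k \<in> a} \<in> \<int>"
proof (induction n)
  case 0
  then show ?case by simp
next
  case (Suc n)
  have "{m. Suc m \<in> {k. n + k \<in> a}} = {k. Suc n + k \<in> a}"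
    by simp
  then have "4 * quaternary {k. n + k \<in> a} = of_bool (n \<in> a) + quaternary {k. Suc n + k \<in> a}"
    using quaternary_step[of "{k. n + k \<in> a}"] by simp
  then have "4 ^ Suc n * quaternary a - quaternary {k. Suc n + k \<in> a}
      = 4 * (4 ^ n * quaternary a - quaternary {k. n + k \<in> a}) + of_bool (n \<in> a)"
    by (simp add: algebra_simps)
  moreover have "\<dots> \<in> \<int>"
    using Suc by (intro Ints_add Ints_mult) auto
  ultimately show ?case by (simp only:)
qed

text \<open>The tail is below 1, so it is the fractional part. Leading digit 1 makes it at least
  1/4, leading digit 0 at most 1/12.\<close>

lemma quaternary_digit: "1 / 4 \<le> frac (4 ^ n * quaternary a) \<longleftrightarrow> n \<in> a"
proof -
  let ?b = "{k. n + k \<in> a}"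
  have "frac (4 ^ n * quaternary a) = quaternary ?b"
    unfolding frac_unique_iff using quaternary_bounds[of ?b] quaternary_shift[of n a] by simp
  moreover have "4 * quaternary ?b = of_bool (n \<in> a) + quaternary {k. Suc k \<in> ?b}"
    using quaternary_step[of ?b] by simp
  ultimately show ?thesis
    using quaternary_bounds[of "{k. Suc k \<in> ?b}"] by (cases "n \<in> a") auto
qed

lemma inj_quaternary: "inj quaternary"
proof (rule injI)
  fix a b assume "quaternary a = quaternary b"
  then have "n \<in> a \<longleftrightarrow> n \<in> b" for n
    using quaternary_digit by metis
  then show "a = b" by blast
qed

text \<open>The set \<open>D n\<close> reads off digit \<open>n\<close>, so the code of
  \<open>quaternary a\<close> is \<open>a\<close> itself, and a pseudo-intersection of the codes
  would be one of the tower.\<close>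

lemma not_tau_gamma_quaternary_tower:
  assumes "tower T"
  shows "\<not> tau_gamma (quaternary ` T)"
proof
  assume tau: "tau_gamma (quaternary ` T)"
  define D :: "nat \<Rightarrow> real set" where "D n = {x. 1 / 4 \<le> frac (4 ^ n * x)}" for n
  have D: "{m. quaternary a \<in> D m} = a" for a
    unfolding D_def mem_Collect_eq quaternary_digit by simp
  have "D n \<in> sets borel" for n
  proof -
    have "(\<lambda>x :: real. 4 ^ n * x - real_of_int \<lfloor>4 ^ n * x\<rfloor>) \<in> borel_measurable borel"
      by measurable
    then have "{x \<in> space borel. 1 / 4 \<le> 4 ^ n * x - real_of_int \<lfloor>4 ^ n * x\<rfloor>} \<in> sets borel"
      by (intro borel_measurable_le) auto
    then show ?thesis
      unfolding D_def frac_def by simp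
  qed
  moreover have "tau_indexed (quaternary ` T) D"
    using assms unfolding tau_indexed_def tower_iff image_image D by simp
  ultimately obtain A where "infinite A" "\<forall>x\<in>quaternary ` T. A \<subseteq>* {m. x \<in> D m}"
    using tau_gamma_pseudo_intersection[OF tau, of D] by blast
  then show False
    using assms unfolding tower_iff by (simp add: D) blast
qed

theorem theorem5p6:
  shows "add (S1 B_Tau B_Gamma) =o \<tt>"
proof -
  define P where "P \<F> \<longleftrightarrow> \<F> \<noteq> {} \<and> \<F> \<subseteq> S1 B_Tau B_Gamma \<and> \<Union>\<F> \<notin> S1 B_Tau B_Gamma" for \<F>
  have add_eq: "add (S1 B_Tau B_Gamma) = min_card P"
    unfolding add_def P_def ..
  obtain T where T: "tower T" "\<tt> = |T|"
    using tower_number_attained_least by blast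
  define X where "X = quaternary ` T"
  have "infinite X"
    unfolding X_def using infinite_tower[OF T(1)]
    by (simp add: finite_image_iff[OF inj_on_subset[OF inj_quaternary subset_UNIV]])
  then obtain C where C: "C \<subseteq> X" "infinite C" "countable C"
    using infinite_countable_subset' by blast
  \<comment> \<open>Adding one point to the fixed set \<open>C\<close> keeps each member countably
    infinite, while the union exhausts \<open>X\<close> with at most \<open>|T|\<close>
    members.\<close>
  define \<F> where "\<F> = (\<lambda>x. insert x C) ` X"
  have "X \<noteq> {}"
    using \<open>infinite X\<close> by blast
  then have "\<Union>\<F> = X" "\<F> \<noteq> {}"
    using C(1) unfolding \<F>_def by blast+
  moreover have "\<F> \<subseteq> S1 B_Tau B_Gamma"
    using C unfolding \<F>_def by (auto simp: S1_B_Tau_B_Gamma_iff intro!: tau_gamma_countable)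
  moreover have "X \<notin> S1 B_Tau B_Gamma"
    using not_tau_gamma_quaternary_tower[OF T(1)] unfolding X_def S1_B_Tau_B_Gamma_iff by simp
  ultimately have "P \<F>"
    unfolding P_def by simp
  from min_card_attained_least[of P, OF this] obtain \<G>
    where \<G>: "P \<G>" "min_card P = |\<G>|" "\<forall>\<H>. P \<H> \<longrightarrow> min_card P \<le>o |\<H>|"
    by blast
  have "|\<F>| \<le>o |T|"
    unfolding \<F>_def X_def image_image by (rule card_of_image)
  with mp[OF spec[OF \<G>(3)] \<open>P \<F>\<close>] have "min_card P \<le>o \<tt>"
    unfolding T(2) by (rule ordLeq_transitive)
  moreover have "\<tt> \<le>o min_card P"
  proof (rule ccontr)
    assume "\<not> \<tt> \<le>o min_card P"
    then have small: "|\<G>| <o \<tt>"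
      using ordLess_or_ordLeq[OF card_of_Well_order card_of_Well_order]
      unfolding \<G>(2) T(2) by blast
    have tau: "tau_gamma Y" and infinite: "infinite Y" if "Y \<in> \<G>" for Y
      using \<G>(1) that S1_B_Tau_B_Gamma_iff unfolding P_def by blast+
    have "tau_gamma (\<Union>\<G>)"
      using tau tau_gamma_Union[OF small, of "\<lambda>Y. Y"] by simp
    \<comment> \<open>Here the clause \<open>\<F> \<noteq> {}\<close> in \<open>add\<close> enters:
      one member is already infinite.\<close>
    moreover have "infinite (\<Union>\<G>)"
    proof -
      obtain Y where "Y \<in> \<G>"
        using \<G>(1) unfolding P_def by blast
      then show ?thesis
        using infinite finite_subset[OF Union_upper] by blast
    qed
    ultimately show False
      using \<G>(1) S1_B_Tau_B_Gamma_iff unfolding P_def by blast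
  qed
  ultimately show ?thesis
    unfolding add_eq ordIso_iff_ordLeq by blast
qed

end
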